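(* For every $2$-degenerate graph $G$, we have $\gamma(G)\le 7\cdot \rho(G)$.
   Context: All graphs are finite and simple. For a vertex $v$ of a graph $G$, $N_G[v]$ denotes the closed neighborhood of $v$ (that is, $v$ together with its neighbors). A dominating set of $G$ is a set of vertices whose closed neighborhoods together cover $V(G)$; $\gamma(G)$ denotes the minimum size of a dominating set of $G$. A packing in $G$ is a set of vertices whose closed neighborhoods are pairwise disjoint (equivalently, the vertices are pairwise at distance at least $3$); $\rho(G)$ denotes the maximum size of a packing in $G$. A graph $G$ is $k$-degenerate if every subgraph of $G$ has a vertex of degree at most $k$. *)

theory Defs
  imports Main
begin

text \<open>
  A graph is given by its vertex set and its set of edges, each edge being a two-element
  set of vertices; this rules out loops and parallel edges. The graph without vertices is allowed.
\<close>

definition fin_graph :: "'a set \<Rightarrow> 'a set set \<Rightarrow> bool" where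
  "fin_graph V E \<longleftrightarrow> finite V \<and> (\<forall>e\<in>E. e \<subseteq> V \<and> card e = 2)"

definition nbhd :: "'a set set \<Rightarrow> 'a \<Rightarrow> 'a set" where
  "nbhd E v = {u. {u, v} \<in> E}"

definition closed_nbhd :: "'a set set \<Rightarrow> 'a \<Rightarrow> 'a set" where
  "closed_nbhd E v = insert v (nbhd E v)"

definition degree :: "'a set set \<Rightarrow> 'a \<Rightarrow> nat" where
  "degree E v = card (nbhd E v)"

definition dominating_set :: "'a set \<Rightarrow> 'a set set \<Rightarrow> 'a set \<Rightarrow> bool" where
  "dominating_set V E D \<longleftrightarrow> D \<subseteq> V \<and> (\<Union>v\<in>D. closed_nbhd E v) = V"

text \<open>
  Disjointness is required for distinct vertices, not merely for distinct neighbourhoods: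
  two vertices with the same closed neighbourhood never lie in a common packing.
\<close>

definition packing :: "'a set \<Rightarrow> 'a set set \<Rightarrow> 'a set \<Rightarrow> bool" where
  "packing V E P \<longleftrightarrow> P \<subseteq> V \<and> pairwise (\<lambda>u v. disjnt (closed_nbhd E u) (closed_nbhd E v)) P"

text \<open>
  For a finite graph the sets below are finite and nonempty: \<open>V\<close> is always
  dominating, and the empty set is always a packing.
\<close>

definition domination_number :: "'a set \<Rightarrow> 'a set set \<Rightarrow> nat" where
  "domination_number V E = Min {card D | D. dominating_set V E D}"

definition packing_number :: "'a set \<Rightarrow> 'a set set \<Rightarrow> nat" where
  "packing_number V E = Max {card P | P. packing V E P}"

definition subgraph :: "'a set \<Rightarrow> 'a set set \<Rightarrow> 'a set \<Rightarrow> 'a set set \<Rightarrow> bool" where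
  "subgraph W F V E \<longleftrightarrow> fin_graph W F \<and> W \<subseteq> V \<and> F \<subseteq> E"

text \<open>Only subgraphs with at least one vertex are considered.\<close>

definition degenerate :: "nat \<Rightarrow> 'a set \<Rightarrow> 'a set set \<Rightarrow> bool" where
  "degenerate k V E \<longleftrightarrow>
     (\<forall>W F. subgraph W F V E \<and> W \<noteq> {} \<longrightarrow> (\<exists>v\<in>W. degree F v \<le> k))"

end

theory Submission
  imports Defs
begin

text \<open>
  Order the vertices so that each has at most two later neighbours, and let \<open>D\<close> be the set of
  vertices still to be dominated, which are also the only ones that may still be packed.
  Call a vertex outside \<open>D\<close> that has two later neighbours in \<open>D\<close> a fork: through it, two vertices of
  \<open>D\<close> conflict in a packing although it is not itself a candidate. The point is to charge forks
  to the bound: there are a set \<open>X\<close> dominating \<open>D\<close> and a packing \<open>P \<subseteq> D\<close> such that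
  \<open>|X| \<le> 7 |P| + f\<close>, where \<open>f\<close> is the number of forks. For \<open>D = V\<close> there are no
  forks, which gives the theorem.

  The proof is by induction on \<open>|D|\<close>. Let \<open>q\<close> be the first vertex of \<open>D\<close> and \<open>T\<close> the set of forks
  that have \<open>q\<close> as a later neighbour. If \<open>|T| \<ge> 2\<close>, then \<open>q\<close> is added to \<open>X\<close> and removed from \<open>D\<close>: the vertices
  of \<open>T\<close> stop being forks and only \<open>q\<close> can become one, so the saving pays for \<open>q\<close>.
  If \<open>|T| \<le> 1\<close>, then \<open>q\<close> is packed. Every vertex of \<open>D\<close> in conflict with \<open>q\<close> is
  dominated by one of the at most three vertices that are in \<open>T\<close> or later neighbours of \<open>q\<close> (by \<open>q\<close>
  itself if there are no such vertices); these
  are added to \<open>X\<close> and what they dominate is removed from \<open>D\<close>. A removed vertex can become a fork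
  only if it is a later neighbour of one of these at most three vertices: there are
  at most four such vertices through the later neighbours of \<open>q\<close>, and at most one, besides \<open>q\<close>, through
  the member of \<open>T\<close>, which itself stops being a fork. So the bound pays \<open>3 + 4 = 7\<close> for \<open>q\<close>.
\<close>

section \<open>Neighbourhoods and vertex orders\<close>

text \<open>The neighbours of \<open>v\<close> that come after \<open>v\<close> in the vertex order given by the ranks \<open>r\<close>.\<close>

definition later_nbhd :: "'a set set \<Rightarrow> ('a \<Rightarrow> nat) \<Rightarrow> 'a \<Rightarrow> 'a set" where
  "later_nbhd E r v = {u \<in> nbhd E v. r v < r u}"

text \<open>
  The forks of \<open>D\<close>. They are automatically vertices of the graph, since a point that is not a vertex
  has no neighbours.
\<close>

definition forks :: "'a set set \<Rightarrow> ('a \<Rightarrow> nat) \<Rightarrow> 'a set \<Rightarrow> 'a set" where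
  "forks E r D = {s. s \<notin> D \<and> 2 \<le> card (later_nbhd E r s \<inter> D)}"

lemma nbhd_sym: "u \<in> nbhd E v \<longleftrightarrow> v \<in> nbhd E u"
  by (simp add: nbhd_def insert_commute)

lemma closed_nbhd_sym: "u \<in> closed_nbhd E v \<longleftrightarrow> v \<in> closed_nbhd E u"
  by (auto simp: closed_nbhd_def nbhd_sym)

lemma nbhd_in_vertices:
  assumes "fin_graph V E" "u \<in> nbhd E v"
  shows "u \<in> V" "v \<in> V" "u \<noteq> v"
proof -
  have e: "{u, v} \<subseteq> V" "card {u, v} = 2"
    using assms by (auto simp: fin_graph_def nbhd_def)
  then show "u \<in> V" "v \<in> V" "u \<noteq> v" by auto
qed

lemma closed_nbhd_subset:
  assumes "fin_graph V E" "v \<in> V"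
  shows "closed_nbhd E v \<subseteq> V"
  using assms nbhd_in_vertices(1) by (fastforce simp: closed_nbhd_def)

lemma later_nbhd_subset:
  assumes "fin_graph V E"
  shows "later_nbhd E r v \<subseteq> V"
  using nbhd_in_vertices(1)[OF assms] by (auto simp: later_nbhd_def)

lemma finite_later_nbhd:
  assumes "fin_graph V E"
  shows "finite (later_nbhd E r v)"
  using later_nbhd_subset[OF assms] assms by (metis fin_graph_def finite_subset)

lemma later_or_earlier:
  assumes "fin_graph V E" "inj_on r V" "u \<in> nbhd E v"
  shows "u \<in> later_nbhd E r v \<or> v \<in> later_nbhd E r u"
proof -
  have "r u \<noteq> r v"
    using nbhd_in_vertices[OF assms(1,3)] assms(2) by (auto dest: inj_onD)
  then show ?thesis
    using assms(3) nbhd_sym by (fastforce simp: later_nbhd_def)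
qed

lemma forks_subset:
  assumes "fin_graph V E"
  shows "forks E r D \<subseteq> V"
proof
  fix s assume "s \<in> forks E r D"
  then have "later_nbhd E r s \<inter> D \<noteq> {}" by (auto simp: forks_def)
  then show "s \<in> V"
    using nbhd_in_vertices(2)[OF assms] by (auto simp: later_nbhd_def)
qed

section \<open>Orders of degenerate graphs\<close>

text \<open>
  The order is built from the front: a vertex of degree at most \<open>k\<close> in the subgraph induced on \<open>W\<close>
  is put before all other vertices of \<open>W\<close>.
\<close>

lemma degenerate_order_on:
  assumes "fin_graph V E" "degenerate k V E" "W \<subseteq> V"
  shows "\<exists>r :: 'a \<Rightarrow> nat. inj_on r W \<and> (\<forall>v\<in>W. card (later_nbhd E r v \<inter> W) \<le> k)"
proof -
  have fV: "finite V" using assms(1) by (simp add: fin_graph_def)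
  show ?thesis
    using assms(3)
  proof (induction "card W" arbitrary: W)
    case 0
    have "finite W" using 0(2) fV by (rule finite_subset)
    then show ?case using 0 by simp
  next
    case (Suc n)
    define F where "F = {e \<in> E. e \<subseteq> W}"
    have fW: "finite W" using Suc.prems fV by (rule finite_subset)
    have "subgraph W F V E"
      using Suc.prems assms(1) fW by (auto simp: subgraph_def fin_graph_def F_def)
    moreover have "W \<noteq> {}" using Suc.hyps(2) by auto
    ultimately obtain v where v: "v \<in> W" "degree F v \<le> k"
      using assms(2) by (auto simp: degenerate_def)
    have "n = card (W - {v})" using Suc.hyps(2) v(1) fW by simp
    then obtain r' :: "'a \<Rightarrow> nat" where r': "inj_on r' (W - {v})"
      "\<forall>w\<in>W - {v}. card (later_nbhd E r' w \<inter> (W - {v})) \<le> k"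
      using Suc.hyps(1)[of "W - {v}"] Suc.prems by blast
    define r where "r w = (if w = v then 0 else Suc (r' w))" for w
    have "inj_on r W"
      using r'(1) by (auto simp: inj_on_def r_def)
    moreover have "card (later_nbhd E r w \<inter> W) \<le> k" if w: "w \<in> W" for w
    proof (cases "w = v")
      case True
      have "later_nbhd E r w \<inter> W \<subseteq> nbhd F v"
        using v(1) True by (auto simp: later_nbhd_def nbhd_def F_def)
      moreover have "finite (nbhd F v)"
        by (rule finite_subset[OF _ fW]) (auto simp: nbhd_def F_def)
      ultimately have "card (later_nbhd E r w \<inter> W) \<le> degree F v"
        unfolding degree_def by (intro card_mono)
      then show ?thesis using v(2) by (rule le_trans)
    next
      case False
      then have "later_nbhd E r w \<inter> W = later_nbhd E r' w \<inter> (W - {v})"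
        by (auto simp: later_nbhd_def r_def)
      then show ?thesis using r'(2) w False by simp
    qed
    ultimately show ?case by blast
  qed
qed

lemma degenerate_order:
  assumes "fin_graph V E" "degenerate k V E"
  obtains r :: "'a \<Rightarrow> nat"
  where "inj_on r V" "\<And>v. v \<in> V \<Longrightarrow> card (later_nbhd E r v) \<le> k"
proof -
  obtain r :: "'a \<Rightarrow> nat" where
    "inj_on r V" "\<forall>v\<in>V. card (later_nbhd E r v \<inter> V) \<le> k"
    using degenerate_order_on[OF assms order.refl] by blast
  moreover have "later_nbhd E r v \<inter> V = later_nbhd E r v" for v
    using later_nbhd_subset[OF assms(1)] by blast
  ultimately show thesis using that by simp
qed

section \<open>Domination and packing with forks\<close>

text \<open>
  Vertices of \<open>D\<close> that cannot be packed together with the first vertex \<open>q\<close> of \<open>D\<close> are dominated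
  by the later neighbours of \<open>q\<close> and the forks
  that have \<open>q\<close> as a later neighbour.
\<close>

lemma conflict_with_first:
  assumes G: "fin_graph V E" and r: "inj_on r V"
    and D: "D \<subseteq> V" "q \<in> D" "\<And>d. d \<in> D \<Longrightarrow> r q \<le> r d"
    and p: "p \<in> D" "p \<noteq> q"
    and meet: "\<not> disjnt (closed_nbhd E p) (closed_nbhd E q)"
  shows "\<exists>x \<in> later_nbhd E r q \<union> {s \<in> forks E r D. q \<in> later_nbhd E r s}. p \<in> closed_nbhd E x"
proof -
  have qp: "r q < r p"
    using r D p by (metis inj_onD le_neq_implies_less subsetD)
  obtain z where z: "z \<in> closed_nbhd E p" "z \<in> closed_nbhd E q"
    using meet by (auto simp: disjnt_def)
  have pz: "p \<in> closed_nbhd E z" using z(1) closed_nbhd_sym by metis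
  consider "z = q" | "z \<in> later_nbhd E r q" | "q \<in> later_nbhd E r z"
    using z(2) later_or_earlier[OF G r] by (auto simp: closed_nbhd_def)
  then show ?thesis
  proof cases
    case 1
    then have "p \<in> later_nbhd E r q"
      using pz p(2) qp by (auto simp: closed_nbhd_def later_nbhd_def)
    then show ?thesis by (auto simp: closed_nbhd_def)
  next
    case 2
    then show ?thesis using pz by blast
  next
    case 3
    \<comment> \<open>Here \<open>z\<close> comes before all of \<open>D\<close> and is adjacent to both \<open>p\<close> and \<open>q\<close>, so it is a fork.\<close>
    then have zq: "r z < r q" by (simp add: later_nbhd_def)
    then have zD: "z \<notin> D" using D(3) by fastforce
    then have "p \<in> later_nbhd E r z"
      using pz p zq qp by (auto simp: closed_nbhd_def later_nbhd_def)
    then have "{p, q} \<subseteq> later_nbhd E r z \<inter> D" using 3 p D by auto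
    then have "card {p, q} \<le> card (later_nbhd E r z \<inter> D)"
      using finite_later_nbhd[OF G] by (intro card_mono) auto
    then have "z \<in> forks E r D" using p(2) zD by (simp add: forks_def)
    then show ?thesis using 3 pz by blast
  qed
qed

text \<open>
  Forks that appear when the vertices dominated by \<open>X\<close> are removed from \<open>D\<close>. A vertex dominated by
  one of its at most two later neighbours keeps at most one later neighbour to be dominated; a vertex
  of \<open>X\<close> keeps none.
\<close>

lemma forks_after_domination:
  assumes G: "fin_graph V E" and r: "inj_on r V"
    and two: "\<And>v. v \<in> V \<Longrightarrow> card (later_nbhd E r v) \<le> 2"
    and s: "s \<in> forks E r (D - (\<Union>x\<in>X. closed_nbhd E x))"
  shows "s \<in> forks E r D \<or> (s \<in> D - X \<and> (\<exists>x\<in>X. s \<in> later_nbhd E r x))"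
    and "later_nbhd E r s \<subseteq> D - (\<Union>x\<in>X. closed_nbhd E x)"
proof -
  let ?D = "D - (\<Union>x\<in>X. closed_nbhd E x)"
  have sV: "s \<in> V" using s forks_subset[OF G] by blast
  have fin: "finite (later_nbhd E r s)" by (rule finite_later_nbhd[OF G])
  have c: "s \<notin> ?D" "2 \<le> card (later_nbhd E r s \<inter> ?D)" using s by (auto simp: forks_def)
  have "later_nbhd E r s \<inter> ?D = later_nbhd E r s"
    using two[OF sV] c(2) fin by (intro card_seteq) auto
  then show sub: "later_nbhd E r s \<subseteq> ?D" by blast
  show "s \<in> forks E r D \<or> (s \<in> D - X \<and> (\<exists>x\<in>X. s \<in> later_nbhd E r x))"
  proof (cases "s \<in> D")
    case False
    have "card (later_nbhd E r s \<inter> ?D) \<le> card (later_nbhd E r s \<inter> D)"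
      using fin by (intro card_mono) auto
    then show ?thesis using False c(2) by (auto simp: forks_def)
  next
    case True
    obtain x where x: "x \<in> X" "s \<in> closed_nbhd E x" using True c(1) by auto
    have "s \<notin> X"
    proof
      assume "s \<in> X"
      then have "later_nbhd E r s \<inter> ?D = {}"
        by (auto simp: later_nbhd_def closed_nbhd_def)
      then show False using c(2) by simp
    qed
    moreover have "x \<notin> later_nbhd E r s"
      using sub x(1) by (auto simp: closed_nbhd_def)
    ultimately have "s \<in> later_nbhd E r x"
      using x later_or_earlier[OF G r, of s x] by (auto simp: closed_nbhd_def)
    then show ?thesis using True \<open>s \<notin> X\<close> x(1) by blast
  qed
qed

lemma packing_insert:
  assumes "packing V E P" "q \<in> V"
    and "\<And>p. p \<in> P \<Longrightarrow> disjnt (closed_nbhd E p) (closed_nbhd E q)"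
  shows "packing V E (insert q P)"
  using assms by (auto simp: packing_def pairwise_insert disjnt_sym)

text \<open>The strengthening of the theorem that carries the induction.\<close>

lemma domination_packing_forks:
  assumes G: "fin_graph V E" and r: "inj_on r V"
    and two: "\<And>v. v \<in> V \<Longrightarrow> card (later_nbhd E r v) \<le> 2"
    and "D \<subseteq> V"
  shows "\<exists>X P. X \<subseteq> V \<and> P \<subseteq> D \<and> D \<subseteq> (\<Union>x\<in>X. closed_nbhd E x) \<and> packing V E P
    \<and> card X \<le> 7 * card P + card (forks E r D)"
  using \<open>D \<subseteq> V\<close>
proof (induction "card D" arbitrary: D rule: less_induct)
  case less
  have fV: "finite V" using G by (simp add: fin_graph_def)
  have fD: "finite D" using less.prems fV finite_subset by blast
  have fF: "finite (forks E r D')" for D' using forks_subset[OF G] fV finite_subset by blast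
  have fL: "finite (later_nbhd E r v)" for v by (rule finite_later_nbhd[OF G])
  show ?case
  proof (cases "D = {}")
    case True
    then show ?thesis
      by (intro exI[of _ "{}"]) (auto simp: packing_def)
  next
    case False
    then obtain q where q: "q \<in> D" "\<And>d. d \<in> D \<Longrightarrow> r q \<le> r d"
      using ex_has_least_nat[of "\<lambda>d. d \<in> D" _ r] by blast
    have qV: "q \<in> V" using q(1) less.prems by blast
    define T where "T = {s \<in> forks E r D. q \<in> later_nbhd E r s}"
    have TF: "T \<subseteq> forks E r D" by (auto simp: T_def)
    have fT: "finite T" using TF fF finite_subset by blast
    have TV: "T \<subseteq> V" using TF forks_subset[OF G] by blast
    show ?thesis
    proof (cases "2 \<le> card T")
      case True
      have sub: "forks E r (D - {q}) \<subseteq> insert q (forks E r D - T)"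
      proof
        fix s assume s: "s \<in> forks E r (D - {q})"
        show "s \<in> insert q (forks E r D - T)"
        proof (cases "s = q")
          case False
          have c: "2 \<le> card (later_nbhd E r s \<inter> (D - {q}))" using s by (auto simp: forks_def)
          have "s \<in> V" using s forks_subset[OF G] by blast
          then have "card (later_nbhd E r s) \<le> card (later_nbhd E r s \<inter> (D - {q}))"
            using two c le_trans by blast
          then have "later_nbhd E r s \<inter> (D - {q}) = later_nbhd E r s"
            using fL by (intro card_seteq) auto
          \<comment> \<open>A fork needs both its later neighbours in \<open>D\<close>, so no member of \<open>T\<close> survives the removal of \<open>q\<close>.\<close>
          then have "q \<notin> later_nbhd E r s" by blast
          moreover have "card (later_nbhd E r s \<inter> (D - {q})) \<le> card (later_nbhd E r s \<inter> D)"
            using fL by (intro card_mono) auto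
          ultimately show ?thesis using False s c by (auto simp: forks_def T_def)
        qed simp
      qed
      have "card (forks E r (D - {q})) \<le> card (insert q (forks E r D - T))"
        using fF by (intro card_mono sub) auto
      also have "\<dots> \<le> Suc (card (forks E r D - T))" by (rule card_insert_le_m1) auto
      finally have "card (forks E r (D - {q})) \<le> Suc (card (forks E r D) - card T)"
        using fT TF by (simp add: card_Diff_subset)
      moreover have "card T \<le> card (forks E r D)" using TF fF by (intro card_mono) auto
      ultimately have k: "card (forks E r (D - {q})) + 1 \<le> card (forks E r D)"
        using True by linarith
      have "card (D - {q}) < card D" using q(1) fD by (rule card_Diff1_less[rotated])
      then obtain X P where IH: "X \<subseteq> V" "P \<subseteq> D - {q}" "D - {q} \<subseteq> (\<Union>x\<in>X. closed_nbhd E x)"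
        "packing V E P" "card X \<le> 7 * card P + card (forks E r (D - {q}))"
        using less.hyps[of "D - {q}"] less.prems by blast
      have "card (insert q X) \<le> Suc (card X)" by (rule card_insert_le_m1) auto
      then have "card (insert q X) \<le> 7 * card P + card (forks E r D)" using IH(5) k by linarith
      moreover have "D \<subseteq> (\<Union>x\<in>insert q X. closed_nbhd E x)"
        using IH(3) by (auto simp: closed_nbhd_def)
      ultimately show ?thesis
        using IH qV by (intro exI[of _ "insert q X"] exI[of _ P]) auto
    next
      case False
      define A where "A = later_nbhd E r q"
      \<comment> \<open>The vertex \<open>q\<close> itself is taken only when nothing else would dominate it.\<close>
      define Y where "Y = (if A \<union> T = {} then {q} else A \<union> T)"
      define D' where "D' = D - (\<Union>y\<in>Y. closed_nbhd E y)"
      have fA: "finite A" and cA: "card A \<le> 2" and AV: "A \<subseteq> V"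
        using fL two[OF qV] later_nbhd_subset[OF G] by (auto simp: A_def)
      have YV: "Y \<subseteq> V" using AV TV qV by (auto simp: Y_def)
      have cY: "card Y \<le> 3"
        using card_Un_le[of A T] cA False by (auto simp: Y_def)
      have qY: "q \<in> (\<Union>y\<in>Y. closed_nbhd E y)"
      proof (cases "A \<union> T = {}")
        case True
        then show ?thesis by (simp add: Y_def closed_nbhd_def)
      next
        case nonempty: False
        have "q \<in> closed_nbhd E y" if "y \<in> A \<union> T" for y
          using that nbhd_sym[of y E q]
          by (auto simp: A_def T_def later_nbhd_def closed_nbhd_def)
        then show ?thesis using nonempty by (auto simp: Y_def)
      qed
      have sub: "forks E r D'
        \<subseteq> (forks E r D - T) \<union> (\<Union>a\<in>A. later_nbhd E r a) \<union> (\<Union>t\<in>T. later_nbhd E r t - {q})"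
      proof
        fix s assume s: "s \<in> forks E r D'"
        note new = forks_after_domination[OF G r two s[unfolded D'_def]]
        have "s \<notin> T"
          using new(2) qY by (auto simp: T_def)
        moreover have "s \<noteq> q"
        proof
          assume "s = q"
          then have "A = {}"
            using new(2) by (auto simp: A_def Y_def closed_nbhd_def split: if_splits)
          then have "later_nbhd E r s = {}" using \<open>s = q\<close> by (simp add: A_def)
          then show False using s by (simp add: forks_def)
        qed
        moreover have "s \<in> forks E r D \<or> (s \<notin> Y \<and> (\<exists>y\<in>Y. s \<in> later_nbhd E r y))"
          using new(1) by blast
        ultimately show "s \<in> (forks E r D - T) \<union> (\<Union>a\<in>A. later_nbhd E r a)
            \<union> (\<Union>t\<in>T. later_nbhd E r t - {q})"
          by (auto simp: Y_def A_def split: if_splits)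
      qed
      have c1: "card (\<Union>a\<in>A. later_nbhd E r a) \<le> 4"
      proof -
        have "card (\<Union>a\<in>A. later_nbhd E r a) \<le> (\<Sum>a\<in>A. card (later_nbhd E r a))"
          using fA by (rule card_UN_le)
        also have "\<dots> \<le> of_nat (card A) * 2"
          using two AV by (intro sum_bounded_above) auto
        finally show ?thesis using cA by simp
      qed
      have c2: "card (\<Union>t\<in>T. later_nbhd E r t - {q}) \<le> card T"
      proof -
        have "card (\<Union>t\<in>T. later_nbhd E r t - {q}) \<le> (\<Sum>t\<in>T. card (later_nbhd E r t - {q}))"
          using fT by (rule card_UN_le)
        also have "\<dots> \<le> of_nat (card T) * 1"
        proof (rule sum_bounded_above)
          fix t assume "t \<in> T"
          then have "q \<in> later_nbhd E r t" "card (later_nbhd E r t) \<le> 2"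
            using two TV by (auto simp: T_def)
          then show "card (later_nbhd E r t - {q}) \<le> 1" using fL by simp
        qed
        finally show ?thesis by simp
      qed
      have "card (forks E r D') \<le> card ((forks E r D - T) \<union> (\<Union>a\<in>A. later_nbhd E r a)
          \<union> (\<Union>t\<in>T. later_nbhd E r t - {q}))"
        using fF fA fT fL by (intro card_mono sub) auto
      also have "\<dots> \<le> card (forks E r D - T) + card (\<Union>a\<in>A. later_nbhd E r a)
          + card (\<Union>t\<in>T. later_nbhd E r t - {q})"
        by (meson add_le_mono1 card_Un_le le_trans)
      also have "\<dots> \<le> (card (forks E r D) - card T) + 4 + card T"
        using c1 c2 fT TF by (simp add: card_Diff_subset)
      finally have k: "card (forks E r D') \<le> card (forks E r D) + 4"
        using card_mono[OF fF TF] by linarith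
      have D': "D' \<subseteq> D" "q \<notin> D'" using qY by (auto simp: D'_def)
      then have "card D' < card D" using q(1) fD by (intro psubset_card_mono) auto
      then obtain X P where IH: "X \<subseteq> V" "P \<subseteq> D'" "D' \<subseteq> (\<Union>x\<in>X. closed_nbhd E x)"
        "packing V E P" "card X \<le> 7 * card P + card (forks E r D')"
        using less.hyps[of D'] less.prems D'(1) by blast
      have "disjnt (closed_nbhd E p) (closed_nbhd E q)" if p: "p \<in> P" for p
      proof (rule ccontr)
        assume "\<not> disjnt (closed_nbhd E p) (closed_nbhd E q)"
        moreover have pD: "p \<in> D'" "p \<in> D" "p \<noteq> q" using p IH(2) D' by auto
        ultimately obtain x where "x \<in> A \<union> T" "p \<in> closed_nbhd E x"
          using conflict_with_first[OF G r less.prems q pD(2,3)] unfolding A_def T_def by blast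
        then show False using pD(1) by (auto simp: D'_def Y_def split: if_splits)
      qed
      then have "packing V E (insert q P)" using IH(4) qV by (intro packing_insert)
      moreover have "card (Y \<union> X) \<le> 7 * card (insert q P) + card (forks E r D)"
      proof -
        have "q \<notin> P" using IH(2) D'(2) by blast
        moreover have "finite P" by (rule finite_subset[OF _ fD]) (use IH(2) D'(1) in blast)
        ultimately show ?thesis using card_Un_le[of Y X] cY IH(5) k by simp
      qed
      moreover have "D \<subseteq> (\<Union>x\<in>Y \<union> X. closed_nbhd E x)" using IH(3) by (auto simp: D'_def)
      moreover have "Y \<union> X \<subseteq> V" "insert q P \<subseteq> D" using IH(1,2) YV D'(1) q(1) by auto
      ultimately show ?thesis by blast
    qed
  qed
qed

section \<open>The bound for \<open>2\<close>-degenerate graphs\<close>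

lemma domination_number_le:
  assumes "fin_graph V E" "dominating_set V E X"
  shows "domination_number V E \<le> card X"
proof -
  have "{card D | D. dominating_set V E D} \<subseteq> card ` Pow V" by (auto simp: dominating_set_def)
  then have "finite {card D | D. dominating_set V E D}"
    by (rule finite_subset) (use assms(1) in \<open>simp add: fin_graph_def\<close>)
  then show ?thesis unfolding domination_number_def using assms(2) by (intro Min_le) auto
qed

lemma card_packing_le:
  assumes "fin_graph V E" "packing V E P"
  shows "card P \<le> packing_number V E"
proof -
  have "{card P | P. packing V E P} \<subseteq> card ` Pow V" by (auto simp: packing_def)
  then have "finite {card P | P. packing V E P}"
    by (rule finite_subset) (use assms(1) in \<open>simp add: fin_graph_def\<close>)
  then show ?thesis unfolding packing_number_def using assms(2) by (intro Max_ge) auto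
qed

theorem theorem1p7:
  fixes V :: "'a set" and E :: "'a set set"
  assumes "fin_graph V E"
    and "degenerate 2 V E"
  shows "domination_number V E \<le> 7 * packing_number V E"
proof -
  obtain r :: "'a \<Rightarrow> nat"
    where r: "inj_on r V" "\<And>v. v \<in> V \<Longrightarrow> card (later_nbhd E r v) \<le> 2"
    using degenerate_order[OF assms] by blast
  have "forks E r V = {}"
    using forks_subset[OF assms(1)] by (fastforce simp: forks_def)
  then obtain X P where XP: "X \<subseteq> V" "V \<subseteq> (\<Union>x\<in>X. closed_nbhd E x)" "packing V E P"
    "card X \<le> 7 * card P"
    using domination_packing_forks[OF assms(1) r order.refl] by auto
  have "dominating_set V E X"
    using XP(1,2) closed_nbhd_subset[OF assms(1)] by (fastforce simp: dominating_set_def)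
  then have "domination_number V E \<le> card X" by (rule domination_number_le[OF assms(1)])
  also have "\<dots> \<le> 7 * card P" by (rule XP(4))
  also have "\<dots> \<le> 7 * packing_number V E" using card_packing_le[OF assms(1) XP(3)] by simp
  finally show ?thesis .
qed

end
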